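(* Let $(X_t)$ be a Markov decision process with countable state set $\mathcal{X}$ and countable action set $\mathcal{U}$, let $E,U\subset\mathcal{X}$ be disjoint sets (target set and forbidden set), and let $H=\mathcal{X}\setminus(U\cup E)$. Suppose that $(X_t)$ with a stationary policy $\pi$ is transient on $H$, i.e. $\mathbb{P}_\pi[X_t\in H\text{ for infinitely many }t\mid X_0\in H]=0$. Let $$K_\pi:=P_H^U(\pi)\,\mathbf{1}_U ,$$ where $\mathbf{1}_U$ is the vector of ones on $U$. Then the safety function $S_\pi(i)=\mathbb{P}_\pi[\tau_U<\tau_E\mid X_0=i]$ is given on $H$ by $$S_\pi|_H=G(\pi)K_\pi,$$ and it is the solution of $$S_\pi|_H=Q(\pi)S_\pi|_H+K_\pi .$$ Furthermore, the sequence $(S_\pi^n)$ defined by $S_\pi^{n+1}=Q(\pi)S_\pi^n+K_\pi$ for an arbitrary $S_\pi^0$ converges point-wise to $S_\pi|_H$.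
   Context: The Markov decision process is given by transition probabilities $p_{iuj}=\mathbb{P}[X_{t+1}=j\mid X_t=i,U_t=u]$ with $\sum_{j}p_{iuj}=1$ and the Markov property. A stationary policy is a matrix $\pi=(\pi_{iu})$ with $\pi_{iu}=\mathbb{P}[U_t=u\mid X_t=i]\ge0$, $\sum_u\pi_{iu}=1$. $\mathbb{P}_\pi$ is the law under $\pi$. The induced Markov chain has transition matrix $P(\pi)=(p_{ij}(\pi))_{i,j\in\mathcal{X}}$, $p_{ij}(\pi)=\sum_{u}\pi_{iu}p_{iuj}$. Put $Q(\pi)=(p_{ij}(\pi))_{i,j\in H}$, $P_H^U(\pi)=(p_{ij}(\pi))_{i\in H,\,j\in U}$ (so $K_\pi(i)=\sum_{j\in U}p_{ij}(\pi)$ for $i\in H$), and $G(\pi)=\sum_{k=0}^\infty Q(\pi)^k$. For a set $A\subset\mathcal{X}$, $\tau_A=\min\{t\ge0 : X_t\in A\}$ is its first hitting time. The functions $S_\pi^n$ are functions on $H$ (column vectors).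
   Formalization: The arbitrary starting function S^0 is required to be bounded on H, and "the solution" means the unique solution among functions bounded on H; for infinite H and unbounded functions both claims fail as stated. *)

theory Defs
  imports "HOL-Probability.Probability"
begin

text \<open>
  \<open>mdp_law p \<pi> M X A\<close>: on the probability space \<open>M\<close>, the state process \<open>X\<close> and the action process
  \<open>A\<close> form a Markov decision process with transition probabilities
  \<open>p\<^sub>i\<^sub>u\<^sub>j = pmf (p i u) j\<close>, controlled by the stationary policy \<open>\<pi>\<^sub>i\<^sub>u = pmf (\<pi> i) u\<close>.
  Both conditional laws are required given the whole history (Markov property); conditioning
  is elementary, hence restricted to histories of positive probability.
\<close>

definition mdp_law ::
  "('x \<Rightarrow> 'u \<Rightarrow> 'x pmf) \<Rightarrow> ('x \<Rightarrow> 'u pmf) \<Rightarrow> 'w measure \<Rightarrow> (nat \<Rightarrow> 'w \<Rightarrow> 'x) \<Rightarrow> (nat \<Rightarrow> 'w \<Rightarrow> 'u) \<Rightarrow> bool"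
where
  "mdp_law p \<pi> M X A \<longleftrightarrow>
     prob_space M \<and>
     (\<forall>t. X t \<in> measurable M (count_space UNIV)) \<and>
     (\<forall>t. A t \<in> measurable M (count_space UNIV)) \<and>
     (\<forall>t x a u.
        \<P>(\<omega> in M. (\<forall>s\<le>t. X s \<omega> = x s) \<and> (\<forall>s<t. A s \<omega> = a s)) > 0 \<longrightarrow>
        \<P>(\<omega> in M. A t \<omega> = u \<bar> (\<forall>s\<le>t. X s \<omega> = x s) \<and> (\<forall>s<t. A s \<omega> = a s)) = pmf (\<pi> (x t)) u) \<and>
     (\<forall>t x a j.
        \<P>(\<omega> in M. \<forall>s\<le>t. X s \<omega> = x s \<and> A s \<omega> = a s) > 0 \<longrightarrow>
        \<P>(\<omega> in M. X (Suc t) \<omega> = j \<bar> \<forall>s\<le>t. X s \<omega> = x s \<and> A s \<omega> = a s) = pmf (p (x t) (a t)) j)"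

text \<open>The law of the process started in \<open>i\<close>, that is \<open>P\<^sub>\<pi>[ \<cdot> | X\<^sub>0 = i ]\<close>.\<close>

definition mdp_law_from ::
  "('x \<Rightarrow> 'u \<Rightarrow> 'x pmf) \<Rightarrow> ('x \<Rightarrow> 'u pmf) \<Rightarrow> 'x \<Rightarrow> 'w measure \<Rightarrow> (nat \<Rightarrow> 'w \<Rightarrow> 'x) \<Rightarrow> (nat \<Rightarrow> 'w \<Rightarrow> 'u) \<Rightarrow> bool"
where
  "mdp_law_from p \<pi> i M X A \<longleftrightarrow> mdp_law p \<pi> M X A \<and> (AE \<omega> in M. X 0 \<omega> = i)"

definition trans_matrix :: "('x \<Rightarrow> 'u \<Rightarrow> 'x pmf) \<Rightarrow> ('x \<Rightarrow> 'u pmf) \<Rightarrow> 'x \<Rightarrow> 'x \<Rightarrow> real" where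
  "trans_matrix p \<pi> i j = (\<Sum>\<^sub>\<infinity>u. pmf (\<pi> i) u * pmf (p i u) j)"

text \<open>
  Matrices and column vectors over countable index sets are total functions; the column index
  set \<open>J\<close> is an explicit argument of the products. Thus \<open>Q(\<pi>) v\<close> is
  \<open>mat_vec H (trans_matrix p \<pi>) v\<close>, read at row indices in \<open>H\<close>.
\<close>

definition mat_vec :: "'x set \<Rightarrow> ('x \<Rightarrow> 'x \<Rightarrow> real) \<Rightarrow> ('x \<Rightarrow> real) \<Rightarrow> 'x \<Rightarrow> real" where
  "mat_vec J B v i = (\<Sum>\<^sub>\<infinity>j\<in>J. B i j * v j)"

primrec mat_pow :: "'x set \<Rightarrow> ('x \<Rightarrow> 'x \<Rightarrow> real) \<Rightarrow> nat \<Rightarrow> 'x \<Rightarrow> 'x \<Rightarrow> real" where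
  "mat_pow J B 0 = (\<lambda>i j. if i = j then 1 else 0)"
| "mat_pow J B (Suc k) = (\<lambda>i j. \<Sum>\<^sub>\<infinity>l\<in>J. B i l * mat_pow J B k l j)"

definition green_matrix :: "'x set \<Rightarrow> ('x \<Rightarrow> 'x \<Rightarrow> real) \<Rightarrow> 'x \<Rightarrow> 'x \<Rightarrow> real" where
  "green_matrix J B i j = (\<Sum>k. mat_pow J B k i j)"

text \<open>The value is \<open>\<infinity>\<close> if the set is never hit.\<close>

definition hit_time :: "(nat \<Rightarrow> 'w \<Rightarrow> 'x) \<Rightarrow> 'x set \<Rightarrow> 'w \<Rightarrow> enat" where
  "hit_time X B \<omega> = Inf (enat ` {t. X t \<omega> \<in> B})"

definition safety_fun ::
  "('x \<Rightarrow> 'w measure) \<Rightarrow> (nat \<Rightarrow> 'w \<Rightarrow> 'x) \<Rightarrow> 'x set \<Rightarrow> 'x set \<Rightarrow> 'x \<Rightarrow> real" where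
  "safety_fun P X U E i = \<P>(\<omega> in P i. hit_time X U \<omega> < hit_time X E \<omega>)"

end

theory Submission imports Defs begin

text \<open>
  Write \<open>Q\<close> for the transition matrix of the induced chain restricted to \<open>H\<close>. It is substochastic,
  and the Markov property says that \<open>(Q\<^sup>k v) i\<close> is the expectation of \<open>v (X\<^sub>k)\<close> on the event that
  the path started in \<open>i\<close> has stayed in \<open>H\<close> up to time \<open>k\<close> (\<open>mdp_confined_expectation\<close>). Everything
  follows from two choices of \<open>v\<close>.

  For \<open>v = 1\<close> one obtains the probability of staying in \<open>H\<close> up to time \<open>k\<close>. A path that stays
  forever visits \<open>H\<close> infinitely often, so transience forces \<open>Q\<^sup>k 1 \<longlonglongrightarrow> 0\<close> pointwise
  (\<open>mdp_confinement_prob_tendsto_0\<close>). For \<open>v = K\<close> one obtains the probability of leaving \<open>H\<close> at time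
  exactly \<open>k + 1\<close> and into \<open>U\<close>. A path started in \<open>H\<close> hits \<open>U\<close> before \<open>E\<close> precisely if its first exit
  from \<open>H\<close> leads into \<open>U\<close>, and these events are disjoint for different exit times. Hence
  \<open>S = (\<Sum>k. Q\<^sup>k K)\<close> on \<open>H\<close> (\<open>mdp_hit_prob_sums\<close>).

  The rest is analysis of a nonnegative matrix with row sums at most one. Interchanging nonnegative
  sums turns the series for \<open>S\<close> into the fixed point equation (\<open>neumann_series_fixpoint\<close>) and into
  \<open>S = G K\<close> (\<open>green_mult_vec\<close>). The error of a bounded iteration obeys \<open>\<bar>S\<^sup>n - S\<bar> \<le> C \<cdot> Q\<^sup>n 1\<close>
  (\<open>iteration_error_le\<close>), which tends to 0; a bounded solution of the fixed point equation is a
  constant iteration, and this gives uniqueness.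

  Finiteness of the entries of \<open>G\<close> does not follow from the convergence of \<open>(\<Sum>k. Q\<^sup>k K)\<close>, because \<open>K\<close>
  may vanish. It rests on a maximum principle: a truncated column of \<open>G\<close> is largest on the
  diagonal (\<open>partial_green_max\<close>). If \<open>Q\<^sup>N 1\<close> is below \<open>1/2\<close> at \<open>j\<close>, splitting
  the truncated sum \<open>g\<close> at the diagonal entry \<open>j\<close> after \<open>N\<close> terms gives \<open>g \<le> N + g / 2\<close>, a bound
  independent of the truncation (\<open>green_summable\<close>).
\<close>

section \<open>Nonnegative double sums and matrix-vector products\<close>

text \<open>
  Fubini's theorem for nonnegative real double sums: finiteness of the total needs to be known in
  one order of summation only.
\<close>

lemma nonneg_has_sum_swap:
  fixes f :: "'a \<Rightarrow> 'b \<Rightarrow> real"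
  assumes nonneg: "\<And>x y. x \<in> A \<Longrightarrow> y \<in> B \<Longrightarrow> 0 \<le> f x y"
    and rows: "\<And>x. x \<in> A \<Longrightarrow> (f x has_sum g x) B"
    and total: "(g has_sum s) A"
    and cols: "\<And>y. y \<in> B \<Longrightarrow> ((\<lambda>x. f x y) has_sum h y) A"
  shows "(h has_sum s) B"
proof -
  have "(\<lambda>(x, y). f x y) summable_on A \<times> B"
    using rows total nonneg by (intro summable_on_SigmaI[where g = g]) (auto simp: summable_on_def)
  then have "((\<lambda>(x, y). f x y) has_sum s) (A \<times> B)"
    by (rule has_sum_SigmaI[OF _ total, rotated]) (use rows in auto)
  then have "((\<lambda>(y, x). f x y) has_sum s) (B \<times> A)"
    by (subst has_sum_swap) simp
  from has_sum_SigmaD[OF this, of h] cols show ?thesis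
    by simp
qed

lemma mat_vec_cong: "(\<And>j. j \<in> J \<Longrightarrow> v j = w j) \<Longrightarrow> mat_vec J B v i = mat_vec J B w i"
  unfolding mat_vec_def by (intro infsum_cong) simp

lemma mat_pow_Suc_mat_vec: "mat_pow J B (Suc k) i j = mat_vec J B (\<lambda>l. mat_pow J B k l j) i"
  by (simp add: mat_vec_def)

lemma bounded_const_image [simp]: "bounded ((\<lambda>_. c) ` S)"
  by (rule bounded_subset[of "{c}"]) auto

section \<open>Substochastic matrices\<close>

locale substochastic =
  fixes H :: "'x set" and Q :: "'x \<Rightarrow> 'x \<Rightarrow> real"
  assumes entry_nonneg: "i \<in> H \<Longrightarrow> 0 \<le> Q i j"
    and row_summable: "i \<in> H \<Longrightarrow> Q i summable_on H"
    and row_sum_le_1: "i \<in> H \<Longrightarrow> infsum (Q i) H \<le> 1"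
begin

abbreviation step :: "('x \<Rightarrow> real) \<Rightarrow> 'x \<Rightarrow> real" where
  "step \<equiv> mat_vec H Q"

text \<open>
  The iterates of the vector of ones. For the matrix of a Markov chain killed on leaving \<open>H\<close> they
  are the probabilities of being alive after \<open>n\<close> steps.
\<close>

abbreviation survival :: "nat \<Rightarrow> 'x \<Rightarrow> real" where
  "survival n \<equiv> (step ^^ n) (\<lambda>_. 1)"

text \<open>
  On bounded vectors the infinite sums that define the product converge absolutely, so the product
  is linear there; without boundedness the default value of divergent sums would break this.
\<close>

lemma step_has_sum:
  assumes i: "i \<in> H" and v: "bounded (v ` H)"
  shows "((\<lambda>j. Q i j * v j) has_sum step v i) H"
proof -
  from v obtain C where C: "\<And>j. j \<in> H \<Longrightarrow> \<bar>v j\<bar> \<le> C"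
    by (auto simp: bounded_iff)
  have "(\<lambda>j. Q i j * C) summable_on H"
    using row_summable[OF i] by (rule summable_on_cmult_left)
  then have "(\<lambda>j. norm (Q i j * v j)) summable_on H"
    by (rule summable_on_comparison_test)
       (auto simp: abs_mult entry_nonneg i intro!: mult_left_mono C)
  then show ?thesis
    unfolding mat_vec_def by (rule has_sum_infsum[OF abs_summable_summable])
qed

lemma step_diff:
  assumes "i \<in> H" "bounded (v ` H)" "bounded (w ` H)"
  shows "step v i - step w i = step (\<lambda>j. v j - w j) i"
proof -
  have "((\<lambda>j. - (Q i j * w j)) has_sum - step w i) H"
    using step_has_sum[OF assms(1,3)] by (simp add: has_sum_uminus)
  from has_sum_add[OF step_has_sum[OF assms(1,2)] this]
  have "((\<lambda>j. Q i j * v j - Q i j * w j) has_sum (step v i - step w i)) H"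
    by simp
  then show ?thesis
    unfolding mat_vec_def[of H Q "\<lambda>j. v j - w j"]
    by (auto simp: right_diff_distrib dest: infsumI)
qed

lemma step_sum:
  assumes "i \<in> H" "\<And>k. k \<in> F \<Longrightarrow> bounded (f k ` H)"
  shows "step (\<lambda>j. \<Sum>k\<in>F. f k j) i = (\<Sum>k\<in>F. step (f k) i)"
proof -
  have "((\<lambda>j. \<Sum>k\<in>F. Q i j * f k j) has_sum (\<Sum>k\<in>F. step (f k) i)) H"
    using assms(2)
    by (induction F rule: infinite_finite_induct) (auto intro!: has_sum_add step_has_sum assms(1))
  then show ?thesis
    unfolding mat_vec_def[of H Q "\<lambda>j. \<Sum>k\<in>F. f k j"]
    by (auto simp: sum_distrib_left dest: infsumI)
qed

text \<open>
  Monotonicity in a form that absorbs absolute values; by iteration it bounds \<open>Q\<^sup>n v\<close> by a multiple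
  of the survival probabilities.
\<close>

lemma abs_step_le:
  assumes i: "i \<in> H" and w: "bounded (w ` H)"
    and le: "\<And>j. j \<in> H \<Longrightarrow> \<bar>v j\<bar> \<le> C * w j"
  shows "\<bar>step v i\<bar> \<le> C * step w i"
proof -
  from w obtain B where B: "\<And>j. j \<in> H \<Longrightarrow> \<bar>w j\<bar> \<le> B"
    by (auto simp: bounded_iff)
  have "bounded (v ` H)"
    unfolding bounded_iff
  proof (intro exI ballI)
    fix y assume "y \<in> v ` H"
    then obtain j where j: "j \<in> H" "y = v j" by blast
    have "\<bar>v j\<bar> \<le> \<bar>C\<bar> * \<bar>w j\<bar>"
      using le[OF j(1)] by (simp flip: abs_mult)
    also have "\<dots> \<le> \<bar>C\<bar> * B"
      using B[OF j(1)] by (intro mult_left_mono) auto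
    finally show "norm y \<le> \<bar>C\<bar> * B" using j by simp
  qed
  then have v: "((\<lambda>j. Q i j * v j) has_sum step v i) H"
    using i by (rule step_has_sum[rotated])
  have w': "((\<lambda>j. C * (Q i j * w j)) has_sum C * step w i) H"
    by (intro has_sum_cmult_right step_has_sum i w)
  have bnd: "\<bar>Q i j * v j\<bar> \<le> C * (Q i j * w j)" if "j \<in> H" for j
    using mult_left_mono[OF le[OF that] entry_nonneg[OF i, of j]] entry_nonneg[OF i, of j]
    by (simp add: abs_mult mult_ac)
  have "step v i \<le> C * step w i"
    using v w' by (rule has_sum_mono) (use bnd in \<open>auto simp: abs_le_iff\<close>)
  moreover have "- step v i \<le> C * step w i"
    by (rule has_sum_mono[OF _ w', of "\<lambda>j. - (Q i j * v j)"])
       (use bnd v in \<open>auto simp: abs_le_iff has_sum_uminus\<close>)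
  ultimately show ?thesis by simp
qed

lemma step_nonneg: "i \<in> H \<Longrightarrow> (\<And>j. j \<in> H \<Longrightarrow> 0 \<le> v j) \<Longrightarrow> 0 \<le> step v i"
  unfolding mat_vec_def by (intro infsum_nonneg mult_nonneg_nonneg entry_nonneg)

lemma step_one_le_1: "i \<in> H \<Longrightarrow> step (\<lambda>_. 1) i \<le> 1"
  using row_sum_le_1 by (simp add: mat_vec_def)

lemma abs_step_le_const:
  assumes i: "i \<in> H" and le: "\<And>j. j \<in> H \<Longrightarrow> \<bar>v j\<bar> \<le> C"
  shows "\<bar>step v i\<bar> \<le> C"
proof -
  have "0 \<le> C" using le[OF i] by linarith
  have "\<bar>step v i\<bar> \<le> C * step (\<lambda>_. 1) i"
    using i le by (intro abs_step_le) auto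
  also have "\<dots> \<le> C * 1"
    using step_one_le_1[OF i] \<open>0 \<le> C\<close> by (intro mult_left_mono)
  finally show ?thesis by simp
qed

lemma bounded_step:
  assumes "bounded (v ` H)"
  shows "bounded (step v ` H)"
proof -
  from assms obtain C where "\<And>j. j \<in> H \<Longrightarrow> \<bar>v j\<bar> \<le> C"
    by (auto simp: bounded_iff)
  then show ?thesis
    unfolding bounded_iff by (intro exI[of _ C]) (auto intro: abs_step_le_const)
qed

lemma bounded_step_power: "bounded (v ` H) \<Longrightarrow> bounded ((step ^^ n) v ` H)"
  by (induction n) (simp_all add: bounded_step)

lemma step_power_nonneg: "i \<in> H \<Longrightarrow> (\<And>j. j \<in> H \<Longrightarrow> 0 \<le> v j) \<Longrightarrow> 0 \<le> (step ^^ n) v i"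
  by (induction n arbitrary: i) (auto intro: step_nonneg)

lemma abs_step_power_le:
  assumes "\<And>j. j \<in> H \<Longrightarrow> \<bar>v j\<bar> \<le> C" "i \<in> H"
  shows "\<bar>(step ^^ n) v i\<bar> \<le> C * survival n i"
  using assms(2)
proof (induction n arbitrary: i)
  case 0
  then show ?case using assms(1) by simp
next
  case (Suc n)
  have "bounded (survival n ` H)"
    by (intro bounded_step_power) auto
  then show ?case
    using abs_step_le[OF Suc.prems _ Suc.IH] by simp
qed

text \<open>
  The inhomogeneous term cancels in the difference of an iteration and a fixed point, so the error
  evolves by \<open>Q\<close> alone. The constant is a bound for the initial error.
\<close>

lemma iteration_error_le:
  assumes rec: "\<And>n i. i \<in> H \<Longrightarrow> V (Suc n) i = step (V n) i + K i"
    and fixpoint: "\<And>i. i \<in> H \<Longrightarrow> S i = step S i + K i"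
    and S: "bounded (S ` H)" and V: "bounded (V 0 ` H)" and K: "bounded (K ` H)"
  shows "\<exists>C. \<forall>n. \<forall>i\<in>H. \<bar>V n i - S i\<bar> \<le> C * survival n i"
proof -
  have bV: "bounded (V n ` H)" for n
  proof (induction n)
    case (Suc n)
    have "bounded ((\<lambda>i. step (V n) i + K i) ` H)"
      using bounded_step[OF Suc] K by (rule bounded_plus_comp)
    then show ?case using rec by (simp cong: image_cong)
  qed (rule V)
  have "bounded ((\<lambda>i. V 0 i - S i) ` H)"
    using V S by (rule bounded_minus_comp)
  then obtain C where C: "\<And>i. i \<in> H \<Longrightarrow> \<bar>V 0 i - S i\<bar> \<le> C"
    by (auto simp: bounded_iff)
  have "\<bar>V n i - S i\<bar> \<le> C * survival n i" if "i \<in> H" for n i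
    using that
  proof (induction n arbitrary: i)
    case 0
    then show ?case using C by simp
  next
    case (Suc n)
    have "V (Suc n) i - S i = step (\<lambda>j. V n j - S j) i"
      using rec fixpoint Suc.prems step_diff[OF Suc.prems bV S] by simp
    also have "\<bar>\<dots>\<bar> \<le> C * step (survival n) i"
      using Suc.prems Suc.IH by (intro abs_step_le bounded_step_power) auto
    finally show ?case by simp
  qed
  then show ?thesis by blast
qed

text \<open>
  Applying \<open>Q\<close> to the series \<open>S = (\<Sum>k. Q\<^sup>k K)\<close> term by term removes its first term.
\<close>

lemma neumann_series_fixpoint:
  assumes K: "bounded (K ` H)" "\<And>i. i \<in> H \<Longrightarrow> 0 \<le> K i"
    and S: "bounded (S ` H)" "\<And>i. i \<in> H \<Longrightarrow> (\<lambda>k. (step ^^ k) K i) sums S i"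
    and i: "i \<in> H"
  shows "S i = step S i + K i"
proof -
  have "((\<lambda>k. (step ^^ Suc k) K i) has_sum step S i) UNIV"
  proof (rule nonneg_has_sum_swap[where A = H and g = "\<lambda>j. Q i j * S j"])
    show "0 \<le> Q i j * (step ^^ k) K j" if "j \<in> H" for j k
      using i that K(2) by (intro mult_nonneg_nonneg entry_nonneg step_power_nonneg)
    show "((\<lambda>k. Q i j * (step ^^ k) K j) has_sum Q i j * S j) UNIV" if "j \<in> H" for j
      using S(2)[OF that] that K(2)
      by (intro has_sum_cmult_right sums_nonneg_imp_has_sum step_power_nonneg)
    show "((\<lambda>j. Q i j * S j) has_sum step S i) H"
      using i S(1) by (rule step_has_sum)
    show "((\<lambda>j. Q i j * (step ^^ k) K j) has_sum (step ^^ Suc k) K i) H" for k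
      using step_has_sum[OF i bounded_step_power[OF K(1)]] by simp
  qed
  then have "(\<lambda>k. (step ^^ Suc k) K i) sums step S i"
    by (rule has_sum_imp_sums)
  then have "(\<lambda>k. (step ^^ k) K i) sums (step S i + K i)"
    by (subst (asm) sums_Suc_iff) simp
  then show ?thesis
    using S(2)[OF i] by (rule sums_unique2[rotated])
qed

lemma mat_pow_nonneg: "i \<in> H \<Longrightarrow> 0 \<le> mat_pow H Q k i j"
  by (induction k arbitrary: i) (auto intro!: infsum_nonneg mult_nonneg_nonneg entry_nonneg)

lemma mat_pow_le_1: "i \<in> H \<Longrightarrow> mat_pow H Q k i j \<le> 1"
proof (induction k arbitrary: i)
  case (Suc k)
  then have "\<bar>step (\<lambda>l. mat_pow H Q k l j) i\<bar> \<le> 1"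
    by (intro abs_step_le_const) (auto simp: mat_pow_nonneg)
  then show ?case by (simp add: mat_pow_Suc_mat_vec del: mat_pow.simps)
qed simp

lemma bounded_mat_pow_column: "bounded ((\<lambda>l. mat_pow H Q k l j) ` H)"
  unfolding bounded_iff using mat_pow_nonneg mat_pow_le_1 by (intro exI[of _ 1]) auto

text \<open>
  Associativity of the matrix products. Nonnegativity of the vector justifies the
  interchange of the two summations.
\<close>

lemma mat_pow_mult_vec:
  assumes v: "bounded (v ` H)" "\<And>j. j \<in> H \<Longrightarrow> 0 \<le> v j" and i: "i \<in> H"
  shows "((\<lambda>j. mat_pow H Q k i j * v j) has_sum (step ^^ k) v i) H"
  using i
proof (induction k arbitrary: i)
  case 0
  have "(\<lambda>j. mat_pow H Q 0 i j * v j) = (\<lambda>j. if i = j then v i else 0)"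
    by auto
  moreover have "((\<lambda>j. if i = j then v i else 0) has_sum v i) H"
    using 0 by (intro has_sum_finite_neutralI[of "{i}"]) auto
  ultimately show ?case by simp
next
  case (Suc k)
  show ?case
  proof (rule nonneg_has_sum_swap[where A = H and g = "\<lambda>l. Q i l * (step ^^ k) v l"
        and f = "\<lambda>l j. Q i l * (mat_pow H Q k l j * v j)"])
    show "0 \<le> Q i l * (mat_pow H Q k l j * v j)" if "l \<in> H" "j \<in> H" for l j
      using that Suc.prems v(2) by (intro mult_nonneg_nonneg entry_nonneg mat_pow_nonneg)
    show "((\<lambda>j. Q i l * (mat_pow H Q k l j * v j)) has_sum Q i l * (step ^^ k) v l) H"
      if "l \<in> H" for l
      using Suc.IH[OF that] by (rule has_sum_cmult_right)
    show "((\<lambda>l. Q i l * (step ^^ k) v l) has_sum (step ^^ Suc k) v i) H"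
      using step_has_sum[OF Suc.prems bounded_step_power[OF v(1)]] by simp
    show "((\<lambda>l. Q i l * (mat_pow H Q k l j * v j)) has_sum mat_pow H Q (Suc k) i j * v j) H"
      for j
      using has_sum_cmult_left[OF step_has_sum[OF Suc.prems bounded_mat_pow_column[of k j]], of "v j"]
      by (simp add: mat_pow_Suc_mat_vec mult_ac del: mat_pow.simps)
  qed
qed

text \<open>
  The column \<open>j\<close> of the truncated Green matrix; the column index comes first so that a partial
  application is a vector.
\<close>

definition partial_green :: "nat \<Rightarrow> 'x \<Rightarrow> 'x \<Rightarrow> real" where
  "partial_green m j l = (\<Sum>k<m. mat_pow H Q k l j)"

lemma partial_green_nonneg: "l \<in> H \<Longrightarrow> 0 \<le> partial_green m j l"
  unfolding partial_green_def by (intro sum_nonneg mat_pow_nonneg)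

lemma partial_green_mono:
  assumes "l \<in> H" "m \<le> n"
  shows "partial_green m j l \<le> partial_green n j l"
  unfolding partial_green_def using assms by (intro sum_mono2 mat_pow_nonneg) auto

text \<open>
  The maximum principle. For a Markov chain: visits to \<open>j\<close> are counted only once \<open>j\<close> has been reached,
  and from then on at most as many are expected as from \<open>j\<close> itself. The induction uses that off
  the diagonal the column is \<open>Q\<close> times the column truncated one step earlier, an average with total
  weight at most one.
\<close>

lemma partial_green_max:
  assumes "j \<in> H" "l \<in> H"
  shows "partial_green m j l \<le> partial_green m j j"
  using assms(2)
proof (induction m arbitrary: l)
  case 0
  then show ?case by (simp add: partial_green_def)
next
  case (Suc m)
  show ?case
  proof (cases "l = j")
    case False
    then have "partial_green (Suc m) j l = (\<Sum>k<m. mat_pow H Q (Suc k) l j)"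
      unfolding partial_green_def by (subst sum.lessThan_Suc_shift) simp
    also have "\<dots> = step (partial_green m j) l"
      unfolding partial_green_def mat_pow_Suc_mat_vec
      using Suc.prems bounded_mat_pow_column by (subst step_sum) auto
    also have "\<dots> \<le> \<bar>step (partial_green m j) l\<bar>"
      by simp
    also have "\<dots> \<le> partial_green m j j"
      using Suc by (intro abs_step_le_const) (auto simp: partial_green_nonneg)
    also have "\<dots> \<le> partial_green (Suc m) j j"
      using assms(1) by (rule partial_green_mono) simp
    finally show ?thesis .
  qed simp
qed

lemma step_power_partial_green:
  assumes "l \<in> H"
  shows "(step ^^ n) (partial_green m j) l = (\<Sum>k<m. mat_pow H Q (n + k) l j)"
  using assms
proof (induction n arbitrary: l)
  case 0
  then show ?case by (simp add: partial_green_def)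
next
  case (Suc n)
  have "(step ^^ Suc n) (partial_green m j) l = step (\<lambda>l. \<Sum>k<m. mat_pow H Q (n + k) l j) l"
    using Suc.IH by (auto intro: mat_vec_cong)
  also have "\<dots> = (\<Sum>k<m. mat_pow H Q (Suc n + k) l j)"
    using Suc.prems bounded_mat_pow_column
    by (subst step_sum) (auto simp flip: mat_pow_Suc_mat_vec simp del: mat_pow.simps)
  finally show ?case .
qed

end

section \<open>Transient substochastic matrices\<close>

locale transient_substochastic = substochastic +
  assumes survival_tendsto_0: "i \<in> H \<Longrightarrow> (\<lambda>n. survival n i) \<longlonglongrightarrow> 0"
begin

lemma iteration_tendsto_fixpoint:
  assumes "\<And>n i. i \<in> H \<Longrightarrow> V (Suc n) i = step (V n) i + K i"
    and "\<And>i. i \<in> H \<Longrightarrow> S i = step S i + K i"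
    and "bounded (S ` H)" "bounded (V 0 ` H)" "bounded (K ` H)" and i: "i \<in> H"
  shows "(\<lambda>n. V n i) \<longlonglongrightarrow> S i"
proof -
  obtain C where C: "\<And>n. \<bar>V n i - S i\<bar> \<le> C * survival n i"
    using iteration_error_le[of V K S] assms by blast
  have "(\<lambda>n. C * survival n i) \<longlonglongrightarrow> 0"
    using tendsto_mult_right_zero[OF survival_tendsto_0[OF i]] .
  then have "(\<lambda>n. V n i - S i) \<longlonglongrightarrow> 0"
    by (rule Lim_null_comparison[rotated]) (simp add: C)
  then show ?thesis
    by (simp add: LIM_zero_iff)
qed

text \<open>
  The first \<open>N\<close> terms of the diagonal sum are at most \<open>N\<close>. The remaining ones are \<open>Q\<^sup>N\<close> applied to
  a truncated column, hence at most its maximum, the diagonal sum itself, times the survival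
  probability at time \<open>N\<close>. Once that is below \<open>1/2\<close> the remainder can be absorbed on the left.
\<close>

lemma green_summable:
  assumes l: "l \<in> H" and j: "j \<in> H"
  shows "summable (\<lambda>k. mat_pow H Q k l j)"
proof -
  have "\<forall>\<^sub>F n in sequentially. survival n j < 1 / 2"
    using survival_tendsto_0[OF j] by (rule order_tendstoD(2)) simp
  then obtain N where N: "survival N j < 1 / 2"
    by (auto simp: eventually_sequentially)
  have bound: "partial_green m j j \<le> 2 * real N" for m
  proof -
    have "partial_green m j j \<le> partial_green (N + m) j j"
      using j by (rule partial_green_mono) simp
    also have "\<dots> = (\<Sum>k<N. mat_pow H Q k j j) + (\<Sum>k<m. mat_pow H Q (N + k) j j)"
      unfolding partial_green_def by (induction m) auto
    also have "(\<Sum>k<N. mat_pow H Q k j j) \<le> real N"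
      using sum_bounded_above[of "{..<N}" "\<lambda>k. mat_pow H Q k j j" 1] j by (simp add: mat_pow_le_1)
    also have "(\<Sum>k<m. mat_pow H Q (N + k) j j) = (step ^^ N) (partial_green m j) j"
      using step_power_partial_green[OF j] by simp
    also have "\<dots> \<le> \<bar>(step ^^ N) (partial_green m j) j\<bar>"
      by simp
    also have "\<dots> \<le> partial_green m j j * survival N j"
      using j by (intro abs_step_power_le) (auto simp: partial_green_nonneg partial_green_max)
    also have "\<dots> \<le> partial_green m j j * (1 / 2)"
      using N j by (intro mult_left_mono partial_green_nonneg) auto
    finally show ?thesis by simp
  qed
  show ?thesis
  proof (rule summableI_nonneg_bounded)
    show "0 \<le> mat_pow H Q k l j" for k
      using l by (rule mat_pow_nonneg)
    show "(\<Sum>k<m. mat_pow H Q k l j) \<le> 2 * real N" for m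
      using partial_green_max[OF j l, of m] bound[of m] by (simp add: partial_green_def)
  qed
qed

text \<open>
  Both sides sum \<open>(Q\<^sup>k)\<^sub>i\<^sub>j K\<^sub>j\<close> over all \<open>k\<close> and \<open>j\<close>, in different orders.
\<close>

lemma green_mult_vec:
  assumes K: "bounded (K ` H)" "\<And>i. i \<in> H \<Longrightarrow> 0 \<le> K i"
    and i: "i \<in> H" and S: "(\<lambda>k. (step ^^ k) K i) sums s"
  shows "((\<lambda>j. green_matrix H Q i j * K j) has_sum s) H"
proof (rule nonneg_has_sum_swap[where A = UNIV and g = "\<lambda>k. (step ^^ k) K i"])
  show "0 \<le> mat_pow H Q k i j * K j" if "j \<in> H" for k j
    using i K(2)[OF that] by (intro mult_nonneg_nonneg mat_pow_nonneg)
  show "((\<lambda>j. mat_pow H Q k i j * K j) has_sum (step ^^ k) K i) H" for k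
    using K i by (intro mat_pow_mult_vec)
  show "((\<lambda>k. (step ^^ k) K i) has_sum s) UNIV"
    using S i K(2) by (intro sums_nonneg_imp_has_sum step_power_nonneg)
  show "((\<lambda>k. mat_pow H Q k i j * K j) has_sum green_matrix H Q i j * K j) UNIV" if "j \<in> H" for j
    unfolding green_matrix_def using i that
    by (intro has_sum_cmult_left sums_nonneg_imp_has_sum mat_pow_nonneg summable_sums green_summable)
qed

end

section \<open>Transition matrices as expectations\<close>

lemma integrable_pmf_bounded_on:
  fixes f :: "'a \<Rightarrow> real"
  assumes "bounded (f ` B)"
  shows "integrable (measure_pmf q) (\<lambda>x. indicator B x * f x)"
proof -
  from assms obtain C where "\<And>x. x \<in> B \<Longrightarrow> \<bar>f x\<bar> \<le> C"
    by (auto simp: bounded_iff)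
  then have "\<bar>indicator B x * f x\<bar> \<le> \<bar>C\<bar>" for x
    by (cases "x \<in> B") force+
  then show ?thesis
    by (intro measure_pmf.integrable_const_bound[where B = "\<bar>C\<bar>"]) auto
qed

lemma has_sum_pmf_mult:
  fixes f :: "'a \<Rightarrow> real"
  assumes "bounded (f ` B)"
  shows "((\<lambda>x. pmf q x * f x) has_sum measure_pmf.expectation q (\<lambda>x. indicator B x * f x)) B"
proof -
  let ?g = "\<lambda>x. indicator B x * f x"
  have "integrable (measure_pmf q) ?g"
    using assms by (rule integrable_pmf_bounded_on)
  then have "integrable (count_space UNIV) (\<lambda>x. pmf q x * ?g x)"
    unfolding measure_pmf_eq_density by (subst (asm) integrable_density) auto
  then have summable: "Infinite_Set_Sum.abs_summable_on (\<lambda>x. pmf q x * ?g x) UNIV"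
    by (simp add: Infinite_Set_Sum.abs_summable_on_def)
  have "((\<lambda>x. pmf q x * ?g x) has_sum infsum (\<lambda>x. pmf q x * ?g x) UNIV) UNIV"
    using abs_summable_equivalent[THEN iffD2, OF summable]
    by (rule has_sum_infsum[OF abs_summable_summable])
  then have "((\<lambda>x. pmf q x * ?g x) has_sum measure_pmf.expectation q ?g) UNIV"
    by (simp add: pmf_expectation_eq_infsetsum infsetsum_infsum[OF summable])
  then show ?thesis
    by (rule has_sum_cong_neutral[THEN iffD1, rotated -1]) auto
qed

definition policy_kernel :: "('x \<Rightarrow> 'u \<Rightarrow> 'x pmf) \<Rightarrow> ('x \<Rightarrow> 'u pmf) \<Rightarrow> 'x \<Rightarrow> 'x pmf" where
  "policy_kernel p \<pi> i = bind_pmf (\<pi> i) (p i)"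

lemma trans_matrix_eq_pmf: "trans_matrix p \<pi> = (\<lambda>i j. pmf (policy_kernel p \<pi> i) j)"
proof (intro ext)
  fix i j
  have "((\<lambda>u. pmf (\<pi> i) u * pmf (p i u) j) has_sum
      measure_pmf.expectation (\<pi> i) (\<lambda>u. indicator UNIV u * pmf (p i u) j)) UNIV"
    by (intro has_sum_pmf_mult) (auto simp: bounded_iff pmf_le_1 intro!: exI[of _ 1])
  then show "trans_matrix p \<pi> i j = pmf (policy_kernel p \<pi> i) j"
    by (simp add: trans_matrix_def policy_kernel_def pmf_bind infsumI)
qed

lemma mat_vec_pmf_eq_expectation:
  assumes "bounded (v ` B)"
  shows "mat_vec B (\<lambda>i j. pmf (\<kappa> i) j) v i =
    measure_pmf.expectation (\<kappa> i) (\<lambda>j. indicator B j * v j)"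
  unfolding mat_vec_def by (rule infsumI[OF has_sum_pmf_mult[OF assms]])

lemma ennreal_mat_vec_pmf:
  assumes "bounded (v ` B)" and nonneg: "\<And>j. j \<in> B \<Longrightarrow> 0 \<le> v j"
  shows "ennreal (mat_vec B (\<lambda>i j. pmf (\<kappa> i) j) v i) = (\<integral>\<^sup>+ j. ennreal (indicator B j * v j) \<partial>\<kappa> i)"
  unfolding mat_vec_pmf_eq_expectation[OF assms(1)]
  by (intro nn_integral_eq_integral[symmetric] integrable_pmf_bounded_on assms(1))
     (auto simp: indicator_def nonneg)

section \<open>The Markov property of the controlled chain\<close>

lemma pmf_bind_map_Pair:
  "pmf (bind_pmf q (\<lambda>h. map_pmf (Pair h) (r h))) (h, y) = pmf q h * pmf (r h) y"
proof -
  have "pmf (map_pmf (Pair h') (r h')) (h, y) = indicator {h} h' * pmf (r h) y" for h'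
    by (cases "h' = h") (auto simp: pmf_map_inj' inj_on_def pmf_eq_0_set_pmf)
  then show ?thesis
    by (simp add: pmf_bind measure_pmf_single)
qed

lemma measurable_countableI:
  fixes Z :: "'w \<Rightarrow> 'z :: countable"
  assumes "\<And>z. {\<omega> \<in> space M. Z \<omega> = z} \<in> sets M"
  shows "Z \<in> measurable M (count_space UNIV)"
proof -
  have "Z -` {z} \<inter> space M = {\<omega> \<in> space M. Z \<omega> = z}" for z
    by auto
  then show ?thesis
    using assms by (subst measurable_count_space_eq2_countable) auto
qed

lemma (in prob_space) law_is_pmf:
  fixes Z :: "'a \<Rightarrow> 'z :: countable"
  assumes "Z \<in> measurable M (count_space UNIV)"
  obtains q where "measure_pmf q = distr M (count_space UNIV) Z"
proof -
  interpret D: prob_space "distr M (count_space UNIV) Z"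
    using assms by (rule prob_space_distr)
  have "AE z in distr M (count_space UNIV) Z. measure (distr M (count_space UNIV) Z) {z} \<noteq> 0"
    by (subst D.AE_support_countable) (auto intro!: exI[of _ UNIV])
  then have "measure_pmf (Abs_pmf (distr M (count_space UNIV) Z)) = distr M (count_space UNIV) Z"
    by (intro Abs_pmf_inverse) (simp add: D.prob_space_axioms)
  then show ?thesis by (rule that)
qed

text \<open>
  The states up to time \<open>t\<close> and the actions strictly before \<open>t\<close>, so that the action at time \<open>t\<close> is
  still to be chosen. With lists the histories form a countable type, and their law is a probability
  mass function.
\<close>

definition history ::
  "(nat \<Rightarrow> 'w \<Rightarrow> 'x) \<Rightarrow> (nat \<Rightarrow> 'w \<Rightarrow> 'u) \<Rightarrow> nat \<Rightarrow> 'w \<Rightarrow> 'x list \<times> 'u list" where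
  "history X A t \<omega> = (map (\<lambda>s. X s \<omega>) [0..<Suc t], map (\<lambda>s. A s \<omega>) [0..<t])"

lemma history_eq_iff:
  "history X A t \<omega> = (xs, us) \<longleftrightarrow>
     length xs = Suc t \<and> length us = t \<and> (\<forall>s\<le>t. X s \<omega> = xs ! s) \<and> (\<forall>s<t. A s \<omega> = us ! s)"
  by (auto simp: history_def list_eq_iff_nth_eq nth_append less_Suc_eq_le simp del: upt_Suc)

lemma last_fst_history: "last (fst (history X A t \<omega>)) = X t \<omega>"
  by (simp add: history_def)

lemma set_fst_history: "set (fst (history X A t \<omega>)) = (\<lambda>s. X s \<omega>) ` {..t}"
  by (auto simp: history_def simp del: upt_Suc)

lemma measurable_history:
  fixes X :: "nat \<Rightarrow> 'w \<Rightarrow> 'x :: countable" and A :: "nat \<Rightarrow> 'w \<Rightarrow> 'u :: countable"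
  assumes [measurable]: "\<And>t. X t \<in> measurable M (count_space UNIV)"
    "\<And>t. A t \<in> measurable M (count_space UNIV)"
  shows "history X A t \<in> measurable M (count_space UNIV)"
proof (rule measurable_countableI)
  fix h :: "'x list \<times> 'u list"
  obtain xs us where h: "h = (xs, us)" by fastforce
  show "{\<omega> \<in> space M. history X A t \<omega> = h} \<in> sets M"
    unfolding h history_eq_iff by measurable
qed

text \<open>
  The conditional probabilities are prescribed only after histories of positive probability. As an
  equation between unconditional probabilities the law of the next action and state holds for all
  histories, since both sides vanish on null histories.
\<close>

lemma mdp_joint_prob:
  assumes law: "mdp_law p \<pi> M X A"
  shows "\<P>(\<omega> in M. history X A t \<omega> = h \<and> A t \<omega> = u \<and> X (Suc t) \<omega> = j) =
    \<P>(\<omega> in M. history X A t \<omega> = h) * (pmf (\<pi> (last (fst h))) u * pmf (p (last (fst h)) u) j)"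
proof -
  interpret prob_space M using law by (simp add: mdp_law_def)
  have [measurable]: "X t \<in> measurable M (count_space UNIV)" "A t \<in> measurable M (count_space UNIV)" for t
    using law by (auto simp: mdp_law_def)
  obtain xs us where h: "h = (xs, us)" by fastforce
  show ?thesis
  proof (cases "length xs = Suc t \<and> length us = t")
    case False
    then have "history X A t \<omega> \<noteq> h" for \<omega>
      by (auto simp: h history_eq_iff)
    then show ?thesis by simp
  next
    case True
    then have len: "length xs = Suc t" "length us = t" by auto
    then have last: "last xs = xs ! t"
      by (subst last_conv_nth) auto
    let ?past = "\<lambda>\<omega>. (\<forall>s\<le>t. X s \<omega> = xs ! s) \<and> (\<forall>s<t. A s \<omega> = us ! s)"
    let ?now = "\<lambda>\<omega>. \<forall>s\<le>t. X s \<omega> = xs ! s \<and> A s \<omega> = (us @ [u]) ! s"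
    have now_iff: "?now \<omega> \<longleftrightarrow> A t \<omega> = u \<and> ?past \<omega>" for \<omega>
      by (auto simp: nth_append len le_less)
    have action: "\<P>(\<omega> in M. ?now \<omega>) = \<P>(\<omega> in M. ?past \<omega>) * pmf (\<pi> (xs ! t)) u"
    proof (cases "\<P>(\<omega> in M. ?past \<omega>) > 0")
      case True
      then have "\<P>(\<omega> in M. A t \<omega> = u \<bar> ?past \<omega>) = pmf (\<pi> (xs ! t)) u"
        using law unfolding mdp_law_def by blast
      then show ?thesis
        using True by (simp add: cond_prob_def now_iff field_simps)
    next
      case False
      then have "\<P>(\<omega> in M. ?past \<omega>) = 0"
        by (simp add: zero_less_measure_iff)
      moreover have "\<P>(\<omega> in M. ?now \<omega>) \<le> \<P>(\<omega> in M. ?past \<omega>)"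
        by (rule finite_measure_mono) (auto simp: now_iff)
      ultimately show ?thesis by (simp add: measure_le_0_iff)
    qed
    have trans: "\<P>(\<omega> in M. X (Suc t) \<omega> = j \<and> ?now \<omega>) = \<P>(\<omega> in M. ?now \<omega>) * pmf (p (xs ! t) u) j"
    proof (cases "\<P>(\<omega> in M. ?now \<omega>) > 0")
      case True
      then have "\<P>(\<omega> in M. X (Suc t) \<omega> = j \<bar> ?now \<omega>) = pmf (p (xs ! t) ((us @ [u]) ! t)) j"
        using law unfolding mdp_law_def by blast
      then show ?thesis
        using True by (simp add: cond_prob_def nth_append len field_simps)
    next
      case False
      then have "\<P>(\<omega> in M. ?now \<omega>) = 0"
        by (simp add: zero_less_measure_iff)
      moreover have "\<P>(\<omega> in M. X (Suc t) \<omega> = j \<and> ?now \<omega>) \<le> \<P>(\<omega> in M. ?now \<omega>)"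
        by (rule finite_measure_mono) auto
      ultimately show ?thesis by (simp add: measure_le_0_iff)
    qed
    have "\<P>(\<omega> in M. history X A t \<omega> = h \<and> A t \<omega> = u \<and> X (Suc t) \<omega> = j) =
        \<P>(\<omega> in M. X (Suc t) \<omega> = j \<and> ?now \<omega>)"
      unfolding now_iff by (rule arg_cong[where f = prob]) (auto simp: h history_eq_iff len)
    also have "\<dots> = \<P>(\<omega> in M. ?past \<omega>) * (pmf (\<pi> (xs ! t)) u * pmf (p (xs ! t) u) j)"
      by (simp add: trans action)
    also have "\<P>(\<omega> in M. ?past \<omega>) = \<P>(\<omega> in M. history X A t \<omega> = h)"
      by (simp add: h history_eq_iff len)
    finally show ?thesis by (simp add: h last)
  qed
qed

text \<open>
  The joint law of history, action and next state is the composition of the law of the history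
  with the policy and the transition probabilities, because the point masses agree. Integrating
  out the action leaves one step of the induced chain.
\<close>

lemma mdp_markov_step:
  fixes X :: "nat \<Rightarrow> 'w \<Rightarrow> 'x :: countable" and A :: "nat \<Rightarrow> 'w \<Rightarrow> 'u :: countable"
    and f :: "'x list \<times> 'u list \<Rightarrow> ennreal" and v :: "'x \<Rightarrow> ennreal"
  assumes law: "mdp_law p \<pi> M X A"
  shows "(\<integral>\<^sup>+ \<omega>. f (history X A t \<omega>) * v (X (Suc t) \<omega>) \<partial>M) =
    (\<integral>\<^sup>+ \<omega>. f (history X A t \<omega>) * (\<integral>\<^sup>+ j. v j \<partial>policy_kernel p \<pi> (X t \<omega>)) \<partial>M)"
proof -
  interpret prob_space M using law by (simp add: mdp_law_def)
  have X: "X t \<in> measurable M (count_space UNIV)" and A: "A t \<in> measurable M (count_space UNIV)" for t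
    using law by (auto simp: mdp_law_def)
  note [measurable] = X A measurable_history[where X = X and A = A, OF X A]
  let ?Z = "\<lambda>\<omega>. (history X A t \<omega>, A t \<omega>, X (Suc t) \<omega>)"
  have Z[measurable]: "?Z \<in> measurable M (count_space UNIV)"
  proof (rule measurable_countableI)
    fix z :: "('x list \<times> 'u list) \<times> 'u \<times> 'x"
    obtain h u j where z: "z = (h, u, j)" by (cases z) auto
    show "{\<omega> \<in> space M. ?Z \<omega> = z} \<in> sets M"
      unfolding z prod.inject by measurable
  qed
  obtain q where q: "measure_pmf q = distr M (count_space UNIV) (history X A t)"
    by (rule law_is_pmf[of "history X A t"]) auto
  obtain r where r: "measure_pmf r = distr M (count_space UNIV) ?Z"
    using law_is_pmf[OF Z] .
  let ?cur = "\<lambda>h. last (fst h)"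
  have r_eq: "r = bind_pmf q (\<lambda>h. map_pmf (Pair h)
      (bind_pmf (\<pi> (?cur h)) (\<lambda>u. map_pmf (Pair u) (p (?cur h) u))))" (is "r = ?r'")
  proof (rule pmf_eqI)
    fix z :: "('x list \<times> 'u list) \<times> 'u \<times> 'x"
    obtain h u j where z: "z = (h, u, j)" by (cases z) auto
    have "pmf r z = \<P>(\<omega> in M. history X A t \<omega> = h \<and> A t \<omega> = u \<and> X (Suc t) \<omega> = j)"
      by (simp add: pmf.rep_eq r measure_distr z vimage_def Int_def conj_commute)
    also have "\<dots> = pmf q h * (pmf (\<pi> (?cur h)) u * pmf (p (?cur h) u) j)"
      by (simp add: mdp_joint_prob[OF law] pmf.rep_eq[of q] q measure_distr vimage_def Int_def conj_commute)
    also have "\<dots> = pmf ?r' z"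
      by (simp add: z pmf_bind_map_Pair)
    finally show "pmf r z = pmf ?r' z" .
  qed
  have "(\<integral>\<^sup>+ \<omega>. f (history X A t \<omega>) * v (X (Suc t) \<omega>) \<partial>M) = (\<integral>\<^sup>+ (h, u, j). f h * v j \<partial>r)"
    by (simp add: r nn_integral_distr)
  also have "\<dots> = (\<integral>\<^sup>+ h. f h * (\<integral>\<^sup>+ j. v j \<partial>policy_kernel p \<pi> (?cur h)) \<partial>q)"
    by (simp add: r_eq policy_kernel_def nn_integral_cmult)
  also have "\<dots> = (\<integral>\<^sup>+ \<omega>. f (history X A t \<omega>) * (\<integral>\<^sup>+ j. v j \<partial>policy_kernel p \<pi> (X t \<omega>)) \<partial>M)"
    by (simp add: q nn_integral_distr last_fst_history)
  finally show ?thesis .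
qed

lemma mdp_markov_step_confined:
  fixes X :: "nat \<Rightarrow> 'w \<Rightarrow> 'x :: countable" and A :: "nat \<Rightarrow> 'w \<Rightarrow> 'u :: countable"
    and v :: "'x \<Rightarrow> real"
  assumes law: "mdp_law p \<pi> M X A"
    and v: "bounded (v ` B)" "\<And>j. j \<in> B \<Longrightarrow> 0 \<le> v j"
  shows "(\<integral>\<^sup>+ \<omega>. of_bool (\<forall>s\<le>t. X s \<omega> \<in> H) * ennreal (indicator B (X (Suc t) \<omega>) * v (X (Suc t) \<omega>)) \<partial>M) =
    (\<integral>\<^sup>+ \<omega>. of_bool (\<forall>s\<le>t. X s \<omega> \<in> H) * ennreal (mat_vec B (trans_matrix p \<pi>) v (X t \<omega>)) \<partial>M)"
  using mdp_markov_step[OF law, of "\<lambda>h. of_bool (set (fst h) \<subseteq> H)" t "\<lambda>j. ennreal (indicator B j * v j)"]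
  by (simp add: set_fst_history image_subset_iff Ball_def trans_matrix_eq_pmf ennreal_mat_vec_pmf[OF v])

section \<open>Confinement to a set and first exit\<close>

lemma substochastic_trans_matrix: "substochastic H (trans_matrix p \<pi>)"
proof
  fix i j
  show "0 \<le> trans_matrix p \<pi> i j"
    by (simp add: trans_matrix_eq_pmf)
  have "(trans_matrix p \<pi> i has_sum measure (policy_kernel p \<pi> i) H) H"
    using has_sum_pmf_mult[of "\<lambda>_. 1" H "policy_kernel p \<pi> i"]
    by (simp add: trans_matrix_eq_pmf)
  then show "trans_matrix p \<pi> i summable_on H" "infsum (trans_matrix p \<pi> i) H \<le> 1"
    by (auto simp: summable_on_def infsumI)
qed

lemma mat_vec_trans_matrix_one_bounds:
  "0 \<le> mat_vec U (trans_matrix p \<pi>) (\<lambda>_. 1) i"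
  "mat_vec U (trans_matrix p \<pi>) (\<lambda>_. 1) i \<le> 1"
  by (simp_all add: trans_matrix_eq_pmf mat_vec_pmf_eq_expectation)

text \<open>
  The last of the \<open>k\<close> steps is integrated out first, which replaces \<open>v\<close> by \<open>Q v\<close>; therefore the
  induction has to vary \<open>v\<close>.
\<close>

lemma mdp_confined_expectation:
  fixes X :: "nat \<Rightarrow> 'w \<Rightarrow> 'x :: countable" and A :: "nat \<Rightarrow> 'w \<Rightarrow> 'u :: countable"
    and v :: "'x \<Rightarrow> real"
  assumes law: "mdp_law_from p \<pi> i M X A" and i: "i \<in> H"
    and v: "bounded (v ` H)" "\<And>j. j \<in> H \<Longrightarrow> 0 \<le> v j"
  shows "(\<integral>\<^sup>+ \<omega>. of_bool (\<forall>s\<le>k. X s \<omega> \<in> H) * ennreal (v (X k \<omega>)) \<partial>M) =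
    ennreal ((mat_vec H (trans_matrix p \<pi>) ^^ k) v i)"
  using v
proof (induction k arbitrary: v)
  case 0
  interpret prob_space M using law by (simp add: mdp_law_from_def mdp_law_def)
  have "AE \<omega> in M. X 0 \<omega> = i"
    using law by (simp add: mdp_law_from_def)
  then have "(\<integral>\<^sup>+ \<omega>. of_bool (X 0 \<omega> \<in> H) * ennreal (v (X 0 \<omega>)) \<partial>M) = (\<integral>\<^sup>+ \<omega>. ennreal (v i) \<partial>M)"
    by (intro nn_integral_cong_AE, eventually_elim) (simp add: i)
  then show ?case
    by (simp add: emeasure_space_1)
next
  case (Suc k)
  interpret substochastic H "trans_matrix p \<pi>"
    by (rule substochastic_trans_matrix)
  have "(\<integral>\<^sup>+ \<omega>. of_bool (\<forall>s\<le>Suc k. X s \<omega> \<in> H) * ennreal (v (X (Suc k) \<omega>)) \<partial>M) =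
      (\<integral>\<^sup>+ \<omega>. of_bool (\<forall>s\<le>k. X s \<omega> \<in> H) *
        ennreal (indicator H (X (Suc k) \<omega>) * v (X (Suc k) \<omega>)) \<partial>M)"
    by (intro nn_integral_cong) (auto simp: le_Suc_eq indicator_def)
  also have "\<dots> = (\<integral>\<^sup>+ \<omega>. of_bool (\<forall>s\<le>k. X s \<omega> \<in> H) * ennreal (step v (X k \<omega>)) \<partial>M)"
    using law Suc.prems by (intro mdp_markov_step_confined) (auto simp: mdp_law_from_def)
  also have "\<dots> = ennreal ((step ^^ k) (step v) i)"
    using Suc.prems by (intro Suc.IH bounded_step step_nonneg)
  finally show ?case
    by (simp add: funpow_swap1)
qed

lemma mdp_confinement_prob:
  fixes X :: "nat \<Rightarrow> 'w \<Rightarrow> 'x :: countable" and A :: "nat \<Rightarrow> 'w \<Rightarrow> 'u :: countable"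
  assumes law: "mdp_law_from p \<pi> i M X A" and i: "i \<in> H"
  shows "\<P>(\<omega> in M. \<forall>s\<le>k. X s \<omega> \<in> H) = (mat_vec H (trans_matrix p \<pi>) ^^ k) (\<lambda>_. 1) i"
proof -
  interpret prob_space M using law by (simp add: mdp_law_from_def mdp_law_def)
  interpret substochastic H "trans_matrix p \<pi>"
    by (rule substochastic_trans_matrix)
  have [measurable]: "X t \<in> measurable M (count_space UNIV)" for t
    using law by (simp add: mdp_law_from_def mdp_law_def)
  have "emeasure M {\<omega> \<in> space M. \<forall>s\<le>k. X s \<omega> \<in> H} =
      (\<integral>\<^sup>+ \<omega>. indicator {\<omega> \<in> space M. \<forall>s\<le>k. X s \<omega> \<in> H} \<omega> \<partial>M)"
    by (subst nn_integral_indicator) auto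
  also have "\<dots> = (\<integral>\<^sup>+ \<omega>. of_bool (\<forall>s\<le>k. X s \<omega> \<in> H) * ennreal 1 \<partial>M)"
    by (intro nn_integral_cong) (auto simp: indicator_def)
  also have "\<dots> = ennreal (survival k i)"
    using law i by (rule mdp_confined_expectation) auto
  finally show ?thesis
    using i by (simp add: emeasure_eq_measure step_power_nonneg)
qed

lemma mdp_exit_prob:
  fixes X :: "nat \<Rightarrow> 'w \<Rightarrow> 'x :: countable" and A :: "nat \<Rightarrow> 'w \<Rightarrow> 'u :: countable"
  assumes law: "mdp_law_from p \<pi> i M X A" and i: "i \<in> H"
  shows "\<P>(\<omega> in M. (\<forall>s\<le>k. X s \<omega> \<in> H) \<and> X (Suc k) \<omega> \<in> U) =
    (mat_vec H (trans_matrix p \<pi>) ^^ k) (mat_vec U (trans_matrix p \<pi>) (\<lambda>_. 1)) i"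
proof -
  let ?Q = "trans_matrix p \<pi>"
  let ?K = "mat_vec U ?Q (\<lambda>_. 1)"
  interpret prob_space M using law by (simp add: mdp_law_from_def mdp_law_def)
  interpret substochastic H ?Q by (rule substochastic_trans_matrix)
  have [measurable]: "X t \<in> measurable M (count_space UNIV)" for t
    using law by (simp add: mdp_law_from_def mdp_law_def)
  note K = mat_vec_trans_matrix_one_bounds[of U p \<pi>]
  have "emeasure M {\<omega> \<in> space M. (\<forall>s\<le>k. X s \<omega> \<in> H) \<and> X (Suc k) \<omega> \<in> U} =
      (\<integral>\<^sup>+ \<omega>. indicator {\<omega> \<in> space M. (\<forall>s\<le>k. X s \<omega> \<in> H) \<and> X (Suc k) \<omega> \<in> U} \<omega> \<partial>M)"
    by (subst nn_integral_indicator) auto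
  also have "\<dots> = (\<integral>\<^sup>+ \<omega>. of_bool (\<forall>s\<le>k. X s \<omega> \<in> H) *
      ennreal (indicator U (X (Suc k) \<omega>) * 1) \<partial>M)"
    by (intro nn_integral_cong) (auto simp: indicator_def)
  also have "\<dots> = (\<integral>\<^sup>+ \<omega>. of_bool (\<forall>s\<le>k. X s \<omega> \<in> H) * ennreal (?K (X k \<omega>)) \<partial>M)"
    using law by (intro mdp_markov_step_confined) (auto simp: mdp_law_from_def)
  also have "\<dots> = ennreal ((step ^^ k) ?K i)"
    using law i K by (intro mdp_confined_expectation) (auto simp: bounded_iff intro!: exI[of _ 1])
  finally show ?thesis
    using i K by (simp add: emeasure_eq_measure step_power_nonneg)
qed

lemma hit_time_less_iff:
  "hit_time X U \<omega> < hit_time X E \<omega> \<longleftrightarrow> (\<exists>n. X n \<omega> \<in> U \<and> (\<forall>s\<le>n. X s \<omega> \<notin> E))"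
proof -
  have "enat n < hit_time X E \<omega> \<longleftrightarrow> (\<forall>s\<le>n. X s \<omega> \<notin> E)" for n
    unfolding hit_time_def Suc_ile_eq[symmetric] le_Inf_iff by (auto simp: not_less_eq_eq[symmetric])
  then show ?thesis
    by (auto simp: hit_time_def[of X U] Inf_less_iff)
qed

text \<open>The exit time into \<open>U\<close> is the first hitting time of \<open>U\<close>; it is positive since the path starts in \<open>H\<close>.\<close>

lemma hit_time_less_iff_exit:
  assumes disj: "E \<inter> U = {}" and H: "H = UNIV - (U \<union> E)" and start: "X 0 \<omega> \<in> H"
  shows "hit_time X U \<omega> < hit_time X E \<omega> \<longleftrightarrow> (\<exists>k. (\<forall>s\<le>k. X s \<omega> \<in> H) \<and> X (Suc k) \<omega> \<in> U)"
proof
  assume "hit_time X U \<omega> < hit_time X E \<omega>"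
  then obtain m where m: "X m \<omega> \<in> U" "\<forall>s\<le>m. X s \<omega> \<notin> E"
    by (auto simp: hit_time_less_iff)
  define n where "n = (LEAST n. X n \<omega> \<in> U)"
  have n: "X n \<omega> \<in> U" "n \<le> m" "\<And>s. s < n \<Longrightarrow> X s \<omega> \<notin> U"
    unfolding n_def using m(1) by (auto intro: LeastI Least_le dest: not_less_Least)
  obtain k where "n = Suc k"
    using n(1) start H by (cases n) auto
  then show "\<exists>k. (\<forall>s\<le>k. X s \<omega> \<in> H) \<and> X (Suc k) \<omega> \<in> U"
    using n m(2) H by (intro exI[of _ k]) auto
next
  assume "\<exists>k. (\<forall>s\<le>k. X s \<omega> \<in> H) \<and> X (Suc k) \<omega> \<in> U"
  then show "hit_time X U \<omega> < hit_time X E \<omega>"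
    unfolding hit_time_less_iff using disj H by (metis DiffE UnCI disjoint_iff le_Suc_eq)
qed

text \<open>The events of leaving \<open>H\<close> into \<open>U\<close> at different times are disjoint, and up to a null set their union
  is the event \<open>\<tau>\<^sub>U < \<tau>\<^sub>E\<close>.\<close>

lemma mdp_hit_prob_sums:
  fixes X :: "nat \<Rightarrow> 'w \<Rightarrow> 'x :: countable" and A :: "nat \<Rightarrow> 'w \<Rightarrow> 'u :: countable"
  assumes law: "mdp_law_from p \<pi> i M X A" and i: "i \<in> H"
    and disj: "E \<inter> U = {}" and H: "H = UNIV - (U \<union> E)"
  shows "(\<lambda>k. (mat_vec H (trans_matrix p \<pi>) ^^ k) (mat_vec U (trans_matrix p \<pi>) (\<lambda>_. 1)) i) sums
    \<P>(\<omega> in M. hit_time X U \<omega> < hit_time X E \<omega>)"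
proof -
  interpret prob_space M using law by (simp add: mdp_law_from_def mdp_law_def)
  have [measurable]: "X t \<in> measurable M (count_space UNIV)" for t
    using law by (simp add: mdp_law_from_def mdp_law_def)
  let ?exit = "\<lambda>k. {\<omega> \<in> space M. (\<forall>s\<le>k. X s \<omega> \<in> H) \<and> X (Suc k) \<omega> \<in> U}"
  have "disjoint_family ?exit"
    unfolding disjoint_family_on_def
  proof (intro ballI impI)
    fix k l :: nat
    assume "k \<noteq> l"
    then have "Suc k \<le> l \<or> Suc l \<le> k" by auto
    then show "?exit k \<inter> ?exit l = {}" using H by auto
  qed
  then have "(\<lambda>k. prob (?exit k)) sums prob (\<Union>k. ?exit k)"
    by (intro finite_measure_UNION) auto
  also have "prob (\<Union>k. ?exit k) = \<P>(\<omega> in M. hit_time X U \<omega> < hit_time X E \<omega>)"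
  proof (rule finite_measure_eq_AE)
    have "AE \<omega> in M. X 0 \<omega> = i"
      using law by (simp add: mdp_law_from_def)
    then show "AE \<omega> in M. \<omega> \<in> (\<Union>k. ?exit k) \<longleftrightarrow>
        \<omega> \<in> {\<omega> \<in> space M. hit_time X U \<omega> < hit_time X E \<omega>}"
      by eventually_elim (use i in \<open>auto simp: hit_time_less_iff_exit[OF disj H]\<close>)
    show "{\<omega> \<in> space M. hit_time X U \<omega> < hit_time X E \<omega>} \<in> events"
      unfolding hit_time_less_iff by measurable
  qed auto
  finally show ?thesis
    by (simp add: mdp_exit_prob[OF law i])
qed

text \<open>
  The events of staying in \<open>H\<close> up to time \<open>k\<close> decrease to the event of staying forever, on which
  \<open>H\<close> is visited infinitely often.
\<close>

lemma mdp_confinement_prob_tendsto_0: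
  fixes X :: "nat \<Rightarrow> 'w \<Rightarrow> 'x :: countable" and A :: "nat \<Rightarrow> 'w \<Rightarrow> 'u :: countable"
  assumes law: "mdp_law_from p \<pi> i M X A"
    and transient: "\<P>(\<omega> in M. \<exists>\<^sub>\<infinity>t. X t \<omega> \<in> H) = 0"
  shows "(\<lambda>k. \<P>(\<omega> in M. \<forall>s\<le>k. X s \<omega> \<in> H)) \<longlonglongrightarrow> 0"
proof -
  interpret prob_space M using law by (simp add: mdp_law_from_def mdp_law_def)
  have [measurable]: "X t \<in> measurable M (count_space UNIV)" for t
    using law by (simp add: mdp_law_from_def mdp_law_def)
  let ?stay = "\<lambda>k. {\<omega> \<in> space M. \<forall>s\<le>k. X s \<omega> \<in> H}"
  have "(\<lambda>k. prob (?stay k)) \<longlonglongrightarrow> prob (\<Inter>k. ?stay k)"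
    by (intro finite_Lim_measure_decseq) (auto simp: decseq_def)
  moreover have "prob (\<Inter>k. ?stay k) \<le> \<P>(\<omega> in M. \<exists>\<^sub>\<infinity>t. X t \<omega> \<in> H)"
    by (rule finite_measure_mono) (auto simp: INFM_nat)
  ultimately show ?thesis
    by (simp add: transient measure_le_0_iff)
qed

section \<open>The safety function\<close>

theorem lemma3:
  fixes p :: "'x :: countable \<Rightarrow> 'u :: countable \<Rightarrow> 'x pmf"
    and \<pi> :: "'x \<Rightarrow> 'u pmf"
    and P :: "'x \<Rightarrow> 'w measure"
    and X :: "nat \<Rightarrow> 'w \<Rightarrow> 'x"
    and A :: "nat \<Rightarrow> 'w \<Rightarrow> 'u"
    and E U H :: "'x set"
    and Q G :: "'x \<Rightarrow> 'x \<Rightarrow> real"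
    and K S :: "'x \<Rightarrow> real"
  assumes law: "\<And>i. mdp_law_from p \<pi> i (P i) X A"
    and disj: "E \<inter> U = {}"
    and H_eq: "H = UNIV - (U \<union> E)"
    and transient: "\<And>i. i \<in> H \<Longrightarrow> \<P>(\<omega> in P i. \<exists>\<^sub>\<infinity>t. X t \<omega> \<in> H) = 0"
    and Q_eq: "Q = trans_matrix p \<pi>"
    and K_eq: "K = mat_vec U (trans_matrix p \<pi>) (\<lambda>_. 1)"
    and G_eq: "G = green_matrix H Q"
    and S_eq: "S = safety_fun P X U E"
  shows "(\<forall>i\<in>H. (\<forall>j\<in>H. summable (\<lambda>k. mat_pow H Q k i j)) \<and>
                 (\<lambda>j. G i j * K j) summable_on H \<and>
                 S i = mat_vec H G K i)
       \<and> (\<forall>i\<in>H. S i = mat_vec H Q S i + K i)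
       \<and> (\<forall>V. bounded (V ` H) \<and> (\<forall>i\<in>H. V i = mat_vec H Q V i + K i) \<longrightarrow> (\<forall>i\<in>H. V i = S i))
       \<and> (\<forall>Sn. bounded (Sn 0 ` H) \<and> (\<forall>n. \<forall>i\<in>H. Sn (Suc n) i = mat_vec H Q (Sn n) i + K i) \<longrightarrow>
               (\<forall>i\<in>H. (\<lambda>n. Sn n i) \<longlonglongrightarrow> S i))"
proof -
  have K: "bounded (K ` H)" "\<And>i. i \<in> H \<Longrightarrow> 0 \<le> K i"
    using mat_vec_trans_matrix_one_bounds[of U p \<pi>]
    by (auto simp: K_eq bounded_iff intro!: exI[of _ 1])
  have S: "bounded (S ` H)"
  proof -
    have "\<bar>S i\<bar> \<le> 1" for i
    proof -
      interpret prob_space "P i" using law[of i] by (simp add: mdp_law_from_def mdp_law_def)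
      show ?thesis by (simp add: S_eq safety_fun_def)
    qed
    then show ?thesis by (auto simp: bounded_iff)
  qed
  interpret transient_substochastic H Q
  proof (unfold Q_eq, intro transient_substochastic.intro substochastic_trans_matrix
      transient_substochastic_axioms.intro)
    fix i assume "i \<in> H"
    with mdp_confinement_prob_tendsto_0[OF law transient]
    show "(\<lambda>n. (mat_vec H (trans_matrix p \<pi>) ^^ n) (\<lambda>_. 1) i) \<longlonglongrightarrow> 0"
      by (simp add: mdp_confinement_prob[OF law, symmetric])
  qed
  have series: "(\<lambda>k. (step ^^ k) K i) sums S i" if "i \<in> H" for i
    using mdp_hit_prob_sums[OF law that disj H_eq] by (simp add: Q_eq K_eq S_eq safety_fun_def)
  have fixpoint: "S i = step S i + K i" if "i \<in> H" for i
    using K S series that by (rule neumann_series_fixpoint)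
  have limit: "(\<lambda>n. V n i) \<longlonglongrightarrow> S i"
    if "bounded (V 0 ` H)" "\<And>n i. i \<in> H \<Longrightarrow> V (Suc n) i = step (V n) i + K i" "i \<in> H" for V i
    using that(2) fixpoint S that(1) K(1) that(3) by (rule iteration_tendsto_fixpoint)
  have unique: "V i = S i"
    if "bounded (V ` H)" "\<And>i. i \<in> H \<Longrightarrow> V i = step V i + K i" "i \<in> H" for V i
    using limit[of "\<lambda>_. V", OF that] by (simp add: LIMSEQ_const_iff)
  have green: "((\<lambda>j. G i j * K j) has_sum S i) H" if "i \<in> H" for i
    unfolding G_eq using K that series[OF that] by (rule green_mult_vec)
  show ?thesis
  proof (intro conjI ballI allI impI)
    fix i j assume i: "i \<in> H"
    show "(\<lambda>j. G i j * K j) summable_on H"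
      using green[OF i] by (auto simp: summable_on_def)
    show "S i = mat_vec H G K i"
      unfolding mat_vec_def using infsumI[OF green[OF i]] by simp
    show "S i = step S i + K i"
      using i by (rule fixpoint)
    show "summable (\<lambda>k. mat_pow H Q k i j)" if "j \<in> H"
      using i that by (rule green_summable)
  next
    fix V i assume "bounded (V ` H) \<and> (\<forall>i\<in>H. V i = step V i + K i)" "i \<in> H"
    then show "V i = S i"
      by (intro unique) auto
  next
    fix V i
    assume "bounded (V 0 ` H) \<and> (\<forall>n. \<forall>i\<in>H. V (Suc n) i = step (V n) i + K i)" "i \<in> H"
    then show "(\<lambda>n. V n i) \<longlonglongrightarrow> S i"
      by (intro limit) auto
  qed
qed

end
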